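(* Let $R=K[x_1,\ldots,x_n]$, with $n\geq 3$, be a polynomial ring in $n$ variables over a field $K$. Then there exist infinitely many monomial ideals in $R$ that are co-nearly normally torsion-free but do not satisfy the copersistence property.
   Context: $\mathrm{Ass}(R/I)$ is the set of associated primes of $I$ and $\mathrm{Min}(I)$ the set of minimal primes of $I$. A monomial ideal $I \subset R = K[x_1,\dots,x_n]$ is called co-nearly normally torsion-free if there exist a monomial prime ideal $\mathfrak{p}$ (an ideal generated by a set of variables) and an integer $m \geq 1$ such that (i) $\operatorname{Ass}(R/I^t) = \operatorname{Min}(I) \cup \{\mathfrak{p}\}$ for all $1 \leq t \leq m$, and (ii) $\operatorname{Ass}(R/I^t) \subseteq \operatorname{Min}(I) \cup \{\mathfrak{p}\}$ for all $t \geq m+1$. An ideal $I$ in a commutative Noetherian ring $R$ has the copersistence property if $\mathrm{Ass}(R/I^t) \supseteq \mathrm{Ass}(R/I^{t+1})$ for all $t\geq 1$. *)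

theory Defs
  imports
    "HOL-Library.Poly_Mapping"
    "HOL-Library.Cardinality"
    "HOL-Algebra.Algebraic_Closure_Type"
    "HOL-Algebra.Ideal_Product"
begin

section \<open>Associated primes and powers of ideals\<close>

text \<open>
  The associated primes of the \<open>R\<close>-module \<open>R/I\<close>: the prime ideals that are the annihilator of
  an element \<open>f + I\<close> of \<open>R/I\<close>, that is, of the form \<open>(I : f)\<close>.
\<close>

definition assoc_primes :: "('a, 'b) ring_scheme \<Rightarrow> 'a set \<Rightarrow> 'a set set"
  where "assoc_primes R I =
    {P. primeideal P R \<and> (\<exists>f \<in> carrier R. P = {r \<in> carrier R. r \<otimes>\<^bsub>R\<^esub> f \<in> I})}"

definition minimal_primes :: "('a, 'b) ring_scheme \<Rightarrow> 'a set \<Rightarrow> 'a set set"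
  where "minimal_primes R I =
    {P. primeideal P R \<and> I \<subseteq> P \<and> (\<forall>Q. primeideal Q R \<and> I \<subseteq> Q \<and> Q \<subseteq> P \<longrightarrow> Q = P)}"

text \<open>
  The multiplication of \<^const>\<open>ideals_set\<close> is the product of ideals and its unit is the whole
  ring, so its monoid powers are the usual powers of an ideal.
\<close>

abbreviation ideal_power :: "('a, 'b) ring_scheme \<Rightarrow> 'a set \<Rightarrow> nat \<Rightarrow> 'a set"
  where "ideal_power R I t \<equiv> I [^]\<^bsub>ideals_set R\<^esub> t"

definition copersistence :: "('a, 'b) ring_scheme \<Rightarrow> 'a set \<Rightarrow> bool"
  where "copersistence R I \<longleftrightarrow>
    (\<forall>t\<ge>1. assoc_primes R (ideal_power R I t) \<supseteq> assoc_primes R (ideal_power R I (t + 1)))"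


section \<open>Monomial ideals\<close>

text \<open>
  A polynomial is a finitely supported map from exponent vectors \<open>'n \<Rightarrow>\<^sub>0 nat\<close> to
  coefficients; the variables are indexed by the elements of \<open>'n\<close>.
\<close>

type_synonym ('n, 'k) mpoly = "('n \<Rightarrow>\<^sub>0 nat) \<Rightarrow>\<^sub>0 'k"

abbreviation mpoly_ring :: "('n, 'k::field) mpoly ring"
  where "mpoly_ring \<equiv> ring_of_type_algebra"

definition mpoly_monom :: "('n \<Rightarrow>\<^sub>0 nat) \<Rightarrow> ('n, 'k::field) mpoly"
  where "mpoly_monom a = Poly_Mapping.single a 1"

definition mpoly_var :: "'n \<Rightarrow> ('n, 'k::field) mpoly"
  where "mpoly_var i = mpoly_monom (Poly_Mapping.single i 1)"

definition monomial_ideal :: "('n, 'k::field) mpoly set \<Rightarrow> bool"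
  where "monomial_ideal I \<longleftrightarrow> (\<exists>A. I = Idl\<^bsub>mpoly_ring\<^esub> (mpoly_monom ` A))"

definition monomial_prime_ideal :: "('n, 'k::field) mpoly set \<Rightarrow> bool"
  where "monomial_prime_ideal P \<longleftrightarrow> (\<exists>V. P = Idl\<^bsub>mpoly_ring\<^esub> (mpoly_var ` V))"

definition co_nearly_normally_torsion_free :: "('n, 'k::field) mpoly set \<Rightarrow> bool"
  where "co_nearly_normally_torsion_free I \<longleftrightarrow>
    monomial_ideal I \<and>
    (\<exists>P m. monomial_prime_ideal P \<and> m \<ge> 1 \<and>
      (\<forall>t. 1 \<le> t \<and> t \<le> m \<longrightarrow>
        assoc_primes mpoly_ring (ideal_power mpoly_ring I t)
          = minimal_primes mpoly_ring I \<union> {P}) \<and>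
      (\<forall>t\<ge>m + 1.
        assoc_primes mpoly_ring (ideal_power mpoly_ring I t)
          \<subseteq> minimal_primes mpoly_ring I \<union> {P}))"

end

theory Submission
  imports Defs
begin

text \<open>
  For three distinct variables \<open>x\<close>, \<open>y\<close>, \<open>z\<close> and every \<open>k \<ge> 2\<close>, the ideal
  \<open>I = (x^4, x^3 y^2, x^2 y^4 z^k, x y^5 z, y^6 z)\<close> has the required properties, and
  different values of \<open>k\<close> give different ideals.

  The radical of \<open>I\<close> is \<open>(x, y z)\<close>, so the minimal primes are \<open>(x, y)\<close> and \<open>(x, z)\<close>, and the only
  other prime that can be associated to a power of \<open>I\<close> is \<open>(x, y, z)\<close>
  (\<open>assoc_primes_family_power_subset\<close>). With \<open>m = 1\<close> and \<open>p = (x, y, z)\<close>, being co-nearly normally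
  torsion-free amounts to the fact that all three primes are associated to \<open>I\<close> itself
  (\<open>assoc_primes_family\<close>). Copersistence fails because \<open>p\<close> disappears and comes back:

    \<^item> \<open>p\<close> is associated to \<open>I\<close> because of \<open>x^2 y^4 z^(k - 1)\<close>: replacing the generator
      \<open>x^2 y^4 z^k\<close> by \<open>x^2 y^4 z\<close> would give the intersection of the primary ideals
      \<open>(x^4, x^3 y^2, x^2 y^4, x y^5, y^6)\<close> and \<open>(x^3, z)\<close>, and \<open>I\<close> is slightly smaller.

    \<^item> In the square, the generator \<open>x^2 y^4 z^k\<close> contributes nothing, so the defect vanishes: the
      square is the intersection of the squares of the two primary ideals, and \<open>p\<close> is not
      associated to it (\<open>conv_power_two\<close>, \<open>square_exponent_saturated\<close>).

    \<^item> The monomial \<open>x^9 y^5\<close> lies in the cubes of both primary ideals, being equal to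
      \<open>x^4 * x^4 * x y^5\<close> and a multiple of \<open>(x^3)^3\<close>.
      It does not lie in the cube of \<open>I\<close>, where \<open>p\<close> is its annihilator (\<open>cube_exponent_socle\<close>).

  All this is a computation with exponent vectors once associated primes of monomial ideals are
  known to be colon ideals by monomials and to be generated by variables; this is
  \<open>assoc_primes_monomial_span\<close>, proved with leading terms.
\<close>

abbreviation (input) keys :: "('a \<Rightarrow>\<^sub>0 'b::zero) \<Rightarrow> 'a set"
  where "keys \<equiv> Poly_Mapping.keys"

abbreviation (input) lookup :: "('a \<Rightarrow>\<^sub>0 'b::zero) \<Rightarrow> 'a \<Rightarrow> 'b"
  where "lookup \<equiv> Poly_Mapping.lookup"

section \<open>Ideals of a type-class ring\<close>

lemma ring_of_type_algebra_simps [simp]: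
  "carrier ring_of_type_algebra = UNIV"
  "a \<otimes>\<^bsub>ring_of_type_algebra\<^esub> b = a * b"
  "a \<oplus>\<^bsub>ring_of_type_algebra\<^esub> b = a + b"
  "\<one>\<^bsub>ring_of_type_algebra\<^esub> = 1"
  "\<zero>\<^bsub>ring_of_type_algebra\<^esub> = 0"
  by (simp_all add: ring_of_type_algebra_def)

lemma a_inv_ring_of_type_algebra [simp]:
  fixes a :: "'a::comm_ring_1"
  shows "a_inv ring_of_type_algebra a = - a"
proof -
  interpret ring "ring_of_type_algebra :: 'a ring" by (rule ring_from_type_algebra)
  show ?thesis by (rule minus_equality) auto
qed

lemma ideal_type_algebra_iff:
  fixes J :: "'a::comm_ring_1 set"
  shows "ideal J ring_of_type_algebra \<longleftrightarrow>
    0 \<in> J \<and> (\<forall>a\<in>J. \<forall>b\<in>J. a + b \<in> J) \<and> (\<forall>r. \<forall>a\<in>J. r * a \<in> J)"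
proof
  assume "ideal J ring_of_type_algebra"
  then interpret ideal J "ring_of_type_algebra :: 'a ring" .
  show "0 \<in> J \<and> (\<forall>a\<in>J. \<forall>b\<in>J. a + b \<in> J) \<and> (\<forall>r. \<forall>a\<in>J. r * a \<in> J)"
    using additive_subgroup.zero_closed[OF is_additive_subgroup]
      additive_subgroup.a_closed[OF is_additive_subgroup] I_l_closed by simp
next
  interpret R: ring "ring_of_type_algebra :: 'a ring" by (rule ring_from_type_algebra)
  assume J: "0 \<in> J \<and> (\<forall>a\<in>J. \<forall>b\<in>J. a + b \<in> J) \<and> (\<forall>r. \<forall>a\<in>J. r * a \<in> J)"
  have neg: "- a \<in> J" if "a \<in> J" for a
    using J that by (metis mult_minus1)
  show "ideal J ring_of_type_algebra"
  proof (rule idealI)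
    show "subgroup J (add_monoid (ring_of_type_algebra :: 'a ring))"
      using J neg by (intro R.add.subgroupI) auto
    show "r \<otimes>\<^bsub>ring_of_type_algebra\<^esub> a \<in> J" "a \<otimes>\<^bsub>ring_of_type_algebra\<^esub> r \<in> J"
      if "a \<in> J" for a r
      using J that by (simp_all add: mult.commute[of a r])
  qed (rule R.ring_axioms)
qed

lemma primeideal_type_algebra_iff:
  fixes P :: "'a::comm_ring_1 set"
  shows "primeideal P ring_of_type_algebra \<longleftrightarrow>
    ideal P ring_of_type_algebra \<and> P \<noteq> UNIV \<and> (\<forall>a b. a * b \<in> P \<longrightarrow> a \<in> P \<or> b \<in> P)"
proof
  assume "primeideal P ring_of_type_algebra"
  then interpret primeideal P "ring_of_type_algebra :: 'a ring" .
  show "ideal P ring_of_type_algebra \<and> P \<noteq> UNIV \<and> (\<forall>a b. a * b \<in> P \<longrightarrow> a \<in> P \<or> b \<in> P)"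
    using I_notcarr I_prime ideal_axioms by auto
next
  assume "ideal P ring_of_type_algebra \<and> P \<noteq> UNIV \<and> (\<forall>a b. a * b \<in> P \<longrightarrow> a \<in> P \<or> b \<in> P)"
  then show "primeideal P ring_of_type_algebra"
    by (intro primeidealI cring_from_type_algebra) auto
qed


section \<open>Ideals spanned by monomials\<close>

definition monomial_span :: "('n \<Rightarrow>\<^sub>0 nat) set \<Rightarrow> ('n, 'k::field) mpoly set"
  where "monomial_span E = {f. keys f \<subseteq> E}"

text \<open>
  These are the exponent sets \<open>E\<close> for which \<open>monomial_span E\<close> is an ideal. Working with such sets
  instead of with lists of generators turns membership in an ideal into membership of exponents.
\<close>

definition upward_closed :: "('n \<Rightarrow>\<^sub>0 nat) set \<Rightarrow> bool"
  where "upward_closed E \<longleftrightarrow> (\<forall>u\<in>E. \<forall>w. w + u \<in> E)"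

lemma mpoly_monom_mult: "mpoly_monom a * mpoly_monom b = mpoly_monom (a + b)"
  by (simp add: mpoly_monom_def mult_single)

lemma mpoly_monom_in_span [simp]: "mpoly_monom w \<in> monomial_span E \<longleftrightarrow> w \<in> E"
  by (simp add: mpoly_monom_def monomial_span_def)

lemma keys_mpoly_monom_times:
  fixes f :: "('n, 'k::field) mpoly"
  shows "keys (mpoly_monom w * f) = (\<lambda>v. w + v) ` keys f"
proof (rule equalityI)
  show "keys (mpoly_monom w * f) \<subseteq> (\<lambda>v. w + v) ` keys f"
    using keys_mult[of "mpoly_monom w" f] by (auto simp: mpoly_monom_def)
  have "lookup (mpoly_monom w * f) (w + v) = lookup f v" for v
  proof -
    have *: "(lookup (mpoly_monom w :: ('n, 'k) mpoly) l * (\<Sum>q. lookup f q when w + v = l + q))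
        = (lookup f v when l = w)" for l
    proof (cases "l = w")
      case True
      have "(\<Sum>q. lookup f q when w + v = w + q) = (\<Sum>q. lookup f q when q = v)"
        by (rule Sum_any.cong) (auto simp: when_def)
      with True show ?thesis by (simp add: mpoly_monom_def)
    qed (simp add: mpoly_monom_def lookup_single when_def)
    show ?thesis by (simp add: lookup_mult *)
  qed
  then show "(\<lambda>v. w + v) ` keys f \<subseteq> keys (mpoly_monom w * f)"
    by (auto simp: in_keys_iff)
qed

lemma ideal_monomial_span:
  assumes "upward_closed E"
  shows "ideal (monomial_span E :: ('n, 'k::field) mpoly set) mpoly_ring"
  unfolding ideal_type_algebra_iff
proof (intro conjI ballI allI)
  fix a b r :: "('n, 'k) mpoly"
  assume a: "a \<in> monomial_span E"
  show "r * a \<in> monomial_span E"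
    using keys_mult[of r a] a assms by (fastforce simp: monomial_span_def upward_closed_def)
  assume "b \<in> monomial_span E"
  with a show "a + b \<in> monomial_span E"
    using Poly_Mapping.keys_add[of a b] by (auto simp: monomial_span_def)
qed (simp add: monomial_span_def)

text \<open>
  A polynomial is the sum of its terms; the induction removes one term at a time.
\<close>

lemma monomial_span_subset_ideal:
  fixes J :: "('n, 'k::field) mpoly set"
  assumes J: "ideal J mpoly_ring" and E: "\<And>w. w \<in> E \<Longrightarrow> mpoly_monom w \<in> J"
  shows "monomial_span E \<subseteq> J"
proof
  fix f :: "('n, 'k) mpoly" assume "f \<in> monomial_span E"
  then show "f \<in> J"
  proof (induction "card (keys f)" arbitrary: f rule: less_induct)
    case less
    show ?case
    proof (cases "f = 0")
      case True
      then show ?thesis using J by (simp add: ideal_type_algebra_iff)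
    next
      case False
      then obtain w where w: "w \<in> keys f" by (metis keys_eq_empty ex_in_conv)
      define t where "t = Poly_Mapping.single w (lookup f w)"
      have keys: "keys (f - t) = keys f - {w}"
        by (auto simp: t_def in_keys_iff lookup_minus lookup_single when_def split: if_splits)
      have "t = Poly_Mapping.single 0 (lookup f w) * mpoly_monom w"
        by (simp add: t_def mpoly_monom_def mult_single)
      moreover have "w \<in> E" using w less.prems by (auto simp: monomial_span_def)
      ultimately have t: "t \<in> J" using J E by (simp add: ideal_type_algebra_iff)
      have "f - t \<in> J"
      proof (rule less.hyps)
        show "card (keys (f - t)) < card (keys f)"
          unfolding keys using w by (intro card_Diff1_less) auto
        show "f - t \<in> monomial_span E"
          using less.prems keys by (auto simp: monomial_span_def)
      qed
      with t have "(f - t) + t \<in> J" using J unfolding ideal_type_algebra_iff by blast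
      then show ?thesis by simp
    qed
  qed
qed

lemma genideal_eq_monomial_span:
  fixes S :: "('n, 'k::field) mpoly set"
  assumes "upward_closed E" and "S \<subseteq> monomial_span E"
    and "\<And>w. w \<in> E \<Longrightarrow> \<exists>s\<in>S. \<exists>r. mpoly_monom w = r * s"
  shows "Idl\<^bsub>mpoly_ring\<^esub> S = monomial_span E"
proof
  interpret R: ring "mpoly_ring :: ('n, 'k) mpoly ring" by (rule ring_from_type_algebra)
  show "Idl\<^bsub>mpoly_ring\<^esub> S \<subseteq> monomial_span E"
    using R.genideal_minimal ideal_monomial_span assms by blast
  have I: "ideal (Idl\<^bsub>mpoly_ring\<^esub> S) mpoly_ring" by (rule R.genideal_ideal) simp
  show "monomial_span E \<subseteq> Idl\<^bsub>mpoly_ring\<^esub> S"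
  proof (rule monomial_span_subset_ideal[OF I])
    fix w assume "w \<in> E"
    then obtain s r where "s \<in> S" "mpoly_monom w = r * s" using assms(3) by blast
    moreover from this have "s \<in> Idl\<^bsub>mpoly_ring\<^esub> S" using R.genideal_self[of S] by auto
    ultimately show "mpoly_monom w \<in> Idl\<^bsub>mpoly_ring\<^esub> S"
      using I by (simp add: ideal_type_algebra_iff)
  qed
qed

lemma monomial_ideal_span:
  assumes "upward_closed E"
  shows "monomial_ideal (monomial_span E :: ('n, 'k::field) mpoly set)"
  unfolding monomial_ideal_def
proof (rule exI[of _ E], rule sym, rule genideal_eq_monomial_span[OF assms])
  fix w assume "w \<in> E"
  then show "\<exists>s\<in>mpoly_monom ` E. \<exists>r. (mpoly_monom w :: ('n, 'k) mpoly) = r * s"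
    by (intro bexI[of _ "mpoly_monom w"] exI[of _ 1]) auto
qed auto

lemma monomial_span_inject:
  assumes "(monomial_span E :: ('n, 'k::field) mpoly set) = monomial_span F"
  shows "E = F"
proof (rule Set.set_eqI)
  fix w
  show "w \<in> E \<longleftrightarrow> w \<in> F"
    using assms mpoly_monom_in_span[where 'b = 'k, of w E] mpoly_monom_in_span[where 'b = 'k, of w F]
    by simp
qed


subsection \<open>Powers\<close>

lemma ideal_prod_monomial_span:
  assumes A: "upward_closed A" and B: "upward_closed B"
  shows "ideal_prod mpoly_ring (monomial_span A) (monomial_span B)
    = (monomial_span {u + v |u v. u \<in> A \<and> v \<in> B} :: ('n, 'k::field) mpoly set)"
    (is "?L = monomial_span ?C")
proof
  interpret R: ring "mpoly_ring :: ('n, 'k) mpoly ring" by (rule ring_from_type_algebra)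
  show "?L \<subseteq> monomial_span ?C"
  proof
    fix f assume "f \<in> ?L"
    then show "f \<in> monomial_span ?C"
    proof induction
      case (prod i j)
      then show ?case using keys_mult[of i j] by (fastforce simp: monomial_span_def)
    next
      case (sum f g)
      then show ?case using Poly_Mapping.keys_add[of f g] by (auto simp: monomial_span_def)
    qed
  qed
  show "monomial_span ?C \<subseteq> ?L"
  proof (rule monomial_span_subset_ideal)
    show "ideal ?L mpoly_ring"
      by (intro R.ideal_prod_is_ideal ideal_monomial_span A B)
    fix w assume "w \<in> ?C"
    then obtain u v where uv: "u \<in> A" "v \<in> B" "w = u + v" by blast
    have "mpoly_monom u \<otimes>\<^bsub>mpoly_ring\<^esub> mpoly_monom v \<in> ?L"
      by (intro ideal_prod.prod) (use uv in auto)
    then show "mpoly_monom w \<in> ?L" using uv by (simp add: mpoly_monom_mult)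
  qed
qed

primrec sumset_power :: "('n \<Rightarrow>\<^sub>0 nat) set \<Rightarrow> nat \<Rightarrow> ('n \<Rightarrow>\<^sub>0 nat) set"
  where
    "sumset_power E 0 = UNIV"
  | "sumset_power E (Suc t) = {u + v |u v. u \<in> sumset_power E t \<and> v \<in> E}"

lemma upward_closed_sumset_power: "upward_closed (sumset_power E t)"
proof (induction t)
  case (Suc t)
  show ?case unfolding upward_closed_def
  proof (intro ballI allI)
    fix u w assume "u \<in> sumset_power E (Suc t)"
    then obtain a b where "u = a + b" "a \<in> sumset_power E t" "b \<in> E" by auto
    moreover from this have "w + a \<in> sumset_power E t" using Suc by (simp add: upward_closed_def)
    ultimately show "w + u \<in> sumset_power E (Suc t)" by (auto simp flip: add.assoc)
  qed
qed (simp add: upward_closed_def)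

lemma ideal_power_monomial_span:
  assumes "upward_closed E"
  shows "ideal_power mpoly_ring (monomial_span E) t
    = (monomial_span (sumset_power E t) :: ('n, 'k::field) mpoly set)"
proof (induction t)
  case 0
  show ?case by (simp add: ideals_set_def nat_pow_def monomial_span_def)
next
  case (Suc t)
  have "ideal_power mpoly_ring (monomial_span E :: ('n, 'k) mpoly set) (Suc t)
      = ideal_prod mpoly_ring (ideal_power mpoly_ring (monomial_span E) t) (monomial_span E)"
    by (simp add: ideals_set_def nat_pow_def)
  also have "\<dots> = monomial_span (sumset_power E (Suc t))"
    unfolding Suc by (simp add: ideal_prod_monomial_span upward_closed_sumset_power assms)
  finally show ?case .
qed


section \<open>Prime ideals generated by variables\<close>

definition var_exponents :: "'n set \<Rightarrow> ('n \<Rightarrow>\<^sub>0 nat) set"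
  where "var_exponents V = {w. \<exists>i\<in>V. lookup w i \<noteq> 0}"

definition var_prime :: "'n set \<Rightarrow> ('n, 'k::field) mpoly set"
  where "var_prime V = monomial_span (var_exponents V)"

lemma upward_closed_var_exponents: "upward_closed (var_exponents V)"
  by (auto simp: upward_closed_def var_exponents_def lookup_add)

lemma single_in_var_exponents [simp]:
  "Poly_Mapping.single i (Suc 0) \<in> var_exponents V \<longleftrightarrow> i \<in> V"
  by (auto simp: var_exponents_def lookup_single when_def intro: rev_bexI)

lemma var_prime_subset_iff [simp]:
  "(var_prime V :: ('n, 'k::field) mpoly set) \<subseteq> var_prime W \<longleftrightarrow> V \<subseteq> W"
proof
  assume *: "(var_prime V :: ('n, 'k) mpoly set) \<subseteq> var_prime W"
  show "V \<subseteq> W"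
  proof
    fix i assume "i \<in> V"
    then have "(mpoly_var i :: ('n, 'k) mpoly) \<in> var_prime V"
      by (simp add: var_prime_def mpoly_var_def)
    with * have "(mpoly_var i :: ('n, 'k) mpoly) \<in> var_prime W" by blast
    then show "i \<in> W"
      by (simp add: var_prime_def mpoly_var_def)
  qed
next
  assume "V \<subseteq> W"
  then have "var_exponents V \<subseteq> var_exponents W" by (auto simp: var_exponents_def)
  then show "(var_prime V :: ('n, 'k) mpoly set) \<subseteq> var_prime W"
    by (auto simp: var_prime_def monomial_span_def)
qed

lemma var_prime_eq_iff [simp]:
  "(var_prime V :: ('n, 'k::field) mpoly set) = var_prime W \<longleftrightarrow> V = W"
  by (metis subset_antisym var_prime_subset_iff order_refl)

lemma split_off_variable:
  fixes w :: "'n \<Rightarrow>\<^sub>0 nat"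
  assumes "lookup w i \<noteq> 0"
  shows "w = (w - Poly_Mapping.single i 1) + Poly_Mapping.single i 1"
proof (rule poly_mapping_eqI)
  show "lookup w j = lookup (w - Poly_Mapping.single i 1 + Poly_Mapping.single i 1) j" for j
    using assms by (cases "j = i") (simp_all add: lookup_add lookup_minus lookup_single when_def)
qed

lemma monomial_prime_ideal_var_prime:
  "monomial_prime_ideal (var_prime V :: ('n, 'k::field) mpoly set)"
  unfolding monomial_prime_ideal_def var_prime_def
proof (rule exI[of _ V], rule sym, rule genideal_eq_monomial_span[OF upward_closed_var_exponents])
  show "mpoly_var ` V \<subseteq> monomial_span (var_exponents V)"
    by (auto simp: mpoly_var_def)
  fix w assume "w \<in> var_exponents V"
  then obtain i where "i \<in> V" "lookup w i \<noteq> 0" by (auto simp: var_exponents_def)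
  then show "\<exists>s\<in>mpoly_var ` V. \<exists>r. (mpoly_monom w :: ('n, 'k) mpoly) = r * s"
    by (metis imageI mpoly_var_def mpoly_monom_mult split_off_variable)
qed


subsection \<open>A monomial order\<close>

text \<open>
  The primality of ideals generated by variables and the monomiality of associated primes both
  rest on leading terms, hence on a translation-invariant linear order of the exponent vectors.
  The index type carries no order, so an order is pulled back from \<^typ>\<open>nat \<Rightarrow>\<^sub>0 nat\<close> along an
  enumeration of the variables.
\<close>

lemma ex_additive_injection:
  "\<exists>\<iota> :: ('n::finite \<Rightarrow>\<^sub>0 nat) \<Rightarrow> (nat \<Rightarrow>\<^sub>0 nat). inj \<iota> \<and> (\<forall>u v. \<iota> (u + v) = \<iota> u + \<iota> v)"
proof -
  obtain e :: "'n \<Rightarrow> nat" where e: "inj e"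
    using finite_imp_inj_to_nat_seg[of "UNIV :: 'n set"] by auto
  define \<iota> :: "('n \<Rightarrow>\<^sub>0 nat) \<Rightarrow> (nat \<Rightarrow>\<^sub>0 nat)"
    where "\<iota> u = (\<Sum>i\<in>UNIV. Poly_Mapping.single (e i) (lookup u i))" for u
  have "lookup (\<iota> u) (e j) = lookup u j" for u j
    using e by (simp add: \<iota>_def lookup_sum lookup_single when_def inj_eq)
  then have "inj \<iota>" by (intro injI poly_mapping_eqI) metis
  moreover have "\<iota> (u + v) = \<iota> u + \<iota> v" for u v
    by (simp add: \<iota>_def lookup_add single_add sum.distrib)
  ultimately show ?thesis by blast
qed

text \<open>
  The sum of the largest elements of two sets of exponents is a sum of their elements in only one
  way. The sets are arbitrary, so that the terms of a polynomial that already lie in a given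
  monomial ideal can be left out of the comparison.
\<close>

lemma ex_top_exponents:
  fixes A B :: "('n::finite \<Rightarrow>\<^sub>0 nat) set"
  assumes "finite A" "A \<noteq> {}" "finite B" "B \<noteq> {}"
  obtains \<alpha> \<beta> where "\<alpha> \<in> A" "\<beta> \<in> B"
    and "\<And>\<alpha>' \<beta>'. \<lbrakk>\<alpha>' \<in> A; \<beta>' \<in> B; \<alpha>' + \<beta>' = \<alpha> + \<beta>\<rbrakk> \<Longrightarrow> \<alpha>' = \<alpha> \<and> \<beta>' = \<beta>"
proof -
  obtain \<iota> :: "('n \<Rightarrow>\<^sub>0 nat) \<Rightarrow> (nat \<Rightarrow>\<^sub>0 nat)"
    where inj: "inj \<iota>" and add: "\<And>u v. \<iota> (u + v) = \<iota> u + \<iota> v"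
    using ex_additive_injection by blast
  have top: "\<exists>m\<in>S. \<forall>s\<in>S. \<iota> s \<le> \<iota> m" if "finite S" "S \<noteq> {}" for S
  proof -
    have "Max (\<iota> ` S) \<in> \<iota> ` S" using that by simp
    then obtain m where "m \<in> S" "\<iota> m = Max (\<iota> ` S)" by auto
    then show ?thesis using that by (metis Max_ge finite_imageI imageI)
  qed
  obtain \<alpha> where \<alpha>: "\<alpha> \<in> A" "\<And>s. s \<in> A \<Longrightarrow> \<iota> s \<le> \<iota> \<alpha>" using top[of A] assms by blast
  obtain \<beta> where \<beta>: "\<beta> \<in> B" "\<And>s. s \<in> B \<Longrightarrow> \<iota> s \<le> \<iota> \<beta>" using top[of B] assms by blast
  show thesis
  proof (rule that[OF \<alpha>(1) \<beta>(1)])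
    fix \<alpha>' \<beta>' assume *: "\<alpha>' \<in> A" "\<beta>' \<in> B" "\<alpha>' + \<beta>' = \<alpha> + \<beta>"
    then have "\<iota> \<alpha>' + \<iota> \<beta>' = \<iota> \<alpha> + \<iota> \<beta>" by (metis add)
    moreover have "\<iota> \<alpha>' \<le> \<iota> \<alpha>" "\<iota> \<beta>' \<le> \<iota> \<beta>" using * \<alpha> \<beta> by auto
    ultimately have "\<iota> \<alpha>' = \<iota> \<alpha>"
      by (metis add_less_le_mono order_less_le less_irrefl)
    then have "\<alpha>' = \<alpha>" using inj by (simp add: inj_eq)
    with * show "\<alpha>' = \<alpha> \<and> \<beta>' = \<beta>" by simp
  qed
qed

text \<open>
  At an exponent that arises in a single way, no cancellation can occur in a product.
\<close>

lemma lookup_times_unique: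
  fixes f g :: "('n, 'k::field) mpoly"
  assumes "\<And>\<alpha>' \<beta>'. \<lbrakk>\<alpha>' \<in> keys f; \<beta>' \<in> keys g; \<alpha>' + \<beta>' = \<alpha> + \<beta>\<rbrakk> \<Longrightarrow> \<alpha>' = \<alpha>"
  shows "lookup (f * g) (\<alpha> + \<beta>) = lookup f \<alpha> * lookup g \<beta>"
proof -
  have "lookup f l * (\<Sum>q. lookup g q when \<alpha> + \<beta> = l + q) = (lookup f \<alpha> * lookup g \<beta> when l = \<alpha>)"
    for l
  proof (cases "l = \<alpha>")
    case True
    have "(\<Sum>q. lookup g q when \<alpha> + \<beta> = \<alpha> + q) = (\<Sum>q. lookup g q when q = \<beta>)"
      by (rule Sum_any.cong) (auto simp: when_def)
    with True show ?thesis by simp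
  next
    case False
    have "(lookup g q when \<alpha> + \<beta> = l + q) = 0" if "lookup f l \<noteq> 0" for q
      using assms[of l q] False that by (cases "lookup g q = 0") (auto simp: when_def in_keys_iff)
    then have "lookup f l = 0 \<or> (\<Sum>q. lookup g q when \<alpha> + \<beta> = l + q) = 0" by fastforce
    with False show ?thesis by auto
  qed
  then show ?thesis by (simp add: lookup_mult)
qed

text \<open>
  Among the terms of \<open>f\<close> and of \<open>g\<close> that involve no variable of \<open>V\<close>, take the largest ones. Their
  product involves no variable of \<open>V\<close> either and survives in \<open>f * g\<close>.
\<close>

lemma primeideal_var_prime:
  "primeideal (var_prime V :: ('n::finite, 'k::field) mpoly set) mpoly_ring"
  unfolding primeideal_type_algebra_iff
proof (intro conjI allI impI)
  show "ideal (var_prime V :: ('n, 'k) mpoly set) mpoly_ring"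
    unfolding var_prime_def by (rule ideal_monomial_span[OF upward_closed_var_exponents])
  have "(mpoly_monom 0 :: ('n, 'k) mpoly) \<notin> var_prime V"
    by (simp add: var_prime_def var_exponents_def)
  then show "(var_prime V :: ('n, 'k) mpoly set) \<noteq> UNIV" by blast
next
  fix f g :: "('n, 'k) mpoly"
  assume fg: "f * g \<in> var_prime V"
  show "f \<in> var_prime V \<or> g \<in> var_prime V"
  proof (rule ccontr)
    define A where "A = keys f - var_exponents V"
    define B where "B = keys g - var_exponents V"
    assume "\<not> ?thesis"
    then have "A \<noteq> {}" "B \<noteq> {}" by (auto simp: A_def B_def var_prime_def monomial_span_def)
    then obtain \<alpha> \<beta> where \<alpha>\<beta>: "\<alpha> \<in> A" "\<beta> \<in> B"
      and top: "\<And>\<alpha>' \<beta>'. \<lbrakk>\<alpha>' \<in> A; \<beta>' \<in> B; \<alpha>' + \<beta>' = \<alpha> + \<beta>\<rbrakk> \<Longrightarrow> \<alpha>' = \<alpha> \<and> \<beta>' = \<beta>"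
      using ex_top_exponents[of A B] by (auto simp: A_def B_def)
    have sum_out: "u + v \<notin> var_exponents V \<longleftrightarrow> u \<notin> var_exponents V \<and> v \<notin> var_exponents V" for u v
      by (auto simp: var_exponents_def lookup_add)
    have "lookup (f * g) (\<alpha> + \<beta>) = lookup f \<alpha> * lookup g \<beta>"
    proof (rule lookup_times_unique)
      fix \<alpha>' \<beta>' assume *: "\<alpha>' \<in> keys f" "\<beta>' \<in> keys g" "\<alpha>' + \<beta>' = \<alpha> + \<beta>"
      have "\<alpha> + \<beta> \<notin> var_exponents V" using \<alpha>\<beta> sum_out[of \<alpha> \<beta>] by (simp add: A_def B_def)
      then have "\<alpha>' \<in> A" "\<beta>' \<in> B" using * sum_out[of \<alpha>' \<beta>'] by (auto simp: A_def B_def)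
      with * top show "\<alpha>' = \<alpha>" by blast
    qed
    moreover have "lookup f \<alpha> \<noteq> 0" "lookup g \<beta> \<noteq> 0"
      using \<alpha>\<beta> by (auto simp: A_def B_def in_keys_iff)
    ultimately have "\<alpha> + \<beta> \<in> keys (f * g)" by (simp add: in_keys_iff)
    then have "\<alpha> + \<beta> \<in> var_exponents V" using fg by (auto simp: var_prime_def monomial_span_def)
    then show False using \<alpha>\<beta> sum_out[of \<alpha> \<beta>] by (simp add: A_def B_def)
  qed
qed


section \<open>Associated primes of monomial ideals\<close>

lemma primeideal_mpoly_monom:
  fixes P :: "('n::finite, 'k::field) mpoly set"
  assumes P: "primeideal P mpoly_ring" and "mpoly_monom w \<in> P"
  shows "\<exists>i. lookup w i \<noteq> 0 \<and> mpoly_var i \<in> P"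
  using assms(2)
proof (induction "\<Sum>j\<in>UNIV. lookup w j" arbitrary: w rule: less_induct)
  case less
  have "w \<noteq> 0"
  proof
    assume "w = 0"
    with less.prems have "1 \<in> P" by (simp add: mpoly_monom_def)
    then have "r * 1 \<in> P" for r
      using P unfolding primeideal_type_algebra_iff ideal_type_algebra_iff by blast
    with P show False by (auto simp: primeideal_type_algebra_iff)
  qed
  then obtain i where i: "lookup w i \<noteq> 0" by (metis lookup_zero poly_mapping_eqI)
  define v where "v = w - Poly_Mapping.single i 1"
  have w: "w = v + Poly_Mapping.single i 1"
    unfolding v_def by (rule split_off_variable[OF i])
  then have "mpoly_monom v * mpoly_var i \<in> P"
    using less.prems by (simp add: mpoly_var_def mpoly_monom_mult)
  then have "mpoly_monom v \<in> P \<or> mpoly_var i \<in> P"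
    using P by (simp add: primeideal_type_algebra_iff)
  then show ?case
  proof
    assume "mpoly_monom v \<in> P"
    moreover have "(\<Sum>j\<in>UNIV. lookup v j) < (\<Sum>j\<in>UNIV. lookup w j)"
      by (simp add: w lookup_add sum.distrib lookup_single when_def)
    ultimately show ?case using less.hyps w by (fastforce simp: lookup_add)
  qed (use i in blast)
qed

lemma mpoly_monom_in_ideal:
  fixes J :: "('n, 'k::field) mpoly set"
  assumes "ideal J mpoly_ring" and "mpoly_var i \<in> J" and i: "lookup w i \<noteq> 0"
  shows "mpoly_monom w \<in> J"
proof -
  have "mpoly_monom (w - Poly_Mapping.single i 1) * mpoly_var i \<in> J"
    using assms by (simp add: ideal_type_algebra_iff)
  then show ?thesis
    unfolding mpoly_var_def mpoly_monom_mult split_off_variable[OF i, symmetric] .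
qed

lemma var_prime_subset_ideal:
  fixes J :: "('n, 'k::field) mpoly set"
  assumes "ideal J mpoly_ring" and "\<And>i. i \<in> V \<Longrightarrow> mpoly_var i \<in> J"
  shows "var_prime V \<subseteq> J"
  unfolding var_prime_def
proof (rule monomial_span_subset_ideal[OF assms(1)])
  fix w assume "w \<in> var_exponents V"
  then obtain i where "i \<in> V" "lookup w i \<noteq> 0" by (auto simp: var_exponents_def)
  then show "mpoly_monom w \<in> J" using mpoly_monom_in_ideal[OF assms(1) assms(2)] by blast
qed

text \<open>
  Let \<open>\<alpha>\<close> and \<open>\<beta>\<close> be the largest exponents of \<open>g\<close> and of the part of \<open>f\<close> outside \<open>E\<close>. The coefficient
  of \<open>g * f\<close> at \<open>\<alpha> + \<beta>\<close> cannot cancel, hence \<open>\<alpha> + \<beta> \<in> E\<close>. If the monomial of \<open>\<alpha>\<close> is not in the prime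
  \<open>P\<close>, then multiplying \<open>f\<close> by it does not change the colon ideal, because \<open>P\<close> is prime, but it
  moves the term at \<open>\<beta>\<close> into the ideal. The number of terms of \<open>f\<close> outside \<open>E\<close> therefore drops, and
  the induction ends because a colon ideal by an element of the ideal is not proper.
\<close>

lemma leading_monomial_in_colon_prime:
  fixes f g :: "('n::finite, 'k::field) mpoly"
  assumes E: "upward_closed E" and P: "primeideal P mpoly_ring"
    and g: "g \<in> P" "g \<noteq> 0" and "P = {r. r * f \<in> monomial_span E}"
  shows "\<exists>\<alpha>\<in>keys g. mpoly_monom \<alpha> \<in> P"
  using assms(5)
proof (induction "card (keys f - E)" arbitrary: f rule: less_induct)
  case less
  show ?case
  proof (cases "keys f \<subseteq> E")
    case True
    then have "1 \<in> P" using less.prems by (simp add: monomial_span_def)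
    then have "r * 1 \<in> P" for r
      using P unfolding primeideal_type_algebra_iff ideal_type_algebra_iff by blast
    with P show ?thesis by (auto simp: primeideal_type_algebra_iff)
  next
    case False
    have "keys g \<noteq> {}" using g by simp
    with False obtain \<alpha> \<beta> where \<alpha>: "\<alpha> \<in> keys g" and \<beta>: "\<beta> \<in> keys f - E"
      and top: "\<And>\<alpha>' \<beta>'. \<lbrakk>\<alpha>' \<in> keys g; \<beta>' \<in> keys f - E; \<alpha>' + \<beta>' = \<alpha> + \<beta>\<rbrakk>
        \<Longrightarrow> \<alpha>' = \<alpha> \<and> \<beta>' = \<beta>"
      using ex_top_exponents[of "keys g" "keys f - E"] by auto
    have gf: "keys (g * f) \<subseteq> E" using g less.prems by (simp add: monomial_span_def)
    have \<alpha>\<beta>: "\<alpha> + \<beta> \<in> E"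
    proof (rule ccontr)
      assume notE: "\<alpha> + \<beta> \<notin> E"
      have "lookup (g * f) (\<alpha> + \<beta>) = lookup g \<alpha> * lookup f \<beta>"
      proof (rule lookup_times_unique)
        fix \<alpha>' \<beta>' assume *: "\<alpha>' \<in> keys g" "\<beta>' \<in> keys f" "\<alpha>' + \<beta>' = \<alpha> + \<beta>"
        have "\<beta>' \<notin> E" using E notE unfolding *(3)[symmetric] by (auto simp: upward_closed_def)
        with * top show "\<alpha>' = \<alpha>" by blast
      qed
      also have "\<dots> \<noteq> 0" using \<alpha> \<beta> by (simp add: in_keys_iff)
      finally have "\<alpha> + \<beta> \<in> keys (g * f)" by (simp add: in_keys_iff)
      with gf notE show False by blast
    qed
    show ?thesis
    proof (cases "mpoly_monom \<alpha> \<in> P")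
      case False
      define f' where "f' = mpoly_monom \<alpha> * f"
      have "keys f' - E \<subseteq> (\<lambda>v. \<alpha> + v) ` (keys f - E - {\<beta>})"
        using \<alpha>\<beta> E by (auto simp: f'_def keys_mpoly_monom_times upward_closed_def)
      then have "card (keys f' - E) \<le> card (keys f - E - {\<beta>})"
        by (meson card_image_le card_mono finite_Diff finite_imageI finite_keys le_trans)
      also have "\<dots> < card (keys f - E)" using \<beta> by (intro card_Diff1_less) auto
      finally have smaller: "card (keys f' - E) < card (keys f - E)" .
      have "r \<in> P \<longleftrightarrow> r * mpoly_monom \<alpha> \<in> P" for r
        using P False unfolding primeideal_type_algebra_iff ideal_type_algebra_iff
        by (metis mult.commute)
      then have "P = {r. r * f' \<in> monomial_span E}"
        using less.prems by (auto simp: f'_def mult.assoc)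
      with less.hyps smaller show ?thesis by blast
    qed (use \<alpha> in blast)
  qed
qed

text \<open>
  Subtracting from an element of \<open>P\<close> a term whose monomial lies in \<open>P\<close> stays in \<open>P\<close>, so the existence
  of one such term gives all of them.
\<close>

lemma colon_prime_eq_monomial_span:
  fixes f :: "('n::finite, 'k::field) mpoly"
  assumes E: "upward_closed E" and P: "primeideal P mpoly_ring"
    and colon: "P = {r. r * f \<in> monomial_span E}"
  shows "P = monomial_span {w. mpoly_monom w \<in> P}"
proof
  have ideal: "ideal P mpoly_ring" using P by (simp add: primeideal_type_algebra_iff)
  show "monomial_span {w. mpoly_monom w \<in> P} \<subseteq> P"
    by (rule monomial_span_subset_ideal[OF ideal]) simp
  have "keys g \<subseteq> {w. mpoly_monom w \<in> P}" if "g \<in> P" for g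
    using that
  proof (induction "card (keys g)" arbitrary: g rule: less_induct)
    case less
    show ?case
    proof (cases "g = 0")
      case False
      then obtain \<alpha> where \<alpha>: "\<alpha> \<in> keys g" "mpoly_monom \<alpha> \<in> P"
        using leading_monomial_in_colon_prime[OF E P _ _ colon] less.prems by blast
      define g' where "g' = g + Poly_Mapping.single 0 (- lookup g \<alpha>) * mpoly_monom \<alpha>"
      have "g' \<in> P"
        using ideal \<alpha> less.prems unfolding g'_def ideal_type_algebra_iff by blast
      moreover have keys: "keys g' = keys g - {\<alpha>}"
        by (auto simp: g'_def mpoly_monom_def mult_single in_keys_iff lookup_add lookup_single
            when_def split: if_splits)
      moreover have "card (keys g - {\<alpha>}) < card (keys g)"
        using \<alpha> by (intro card_Diff1_less) auto
      ultimately have "keys g' \<subseteq> {w. mpoly_monom w \<in> P}" using less.hyps[of g'] by simp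
      with keys \<alpha> show ?thesis by auto
    qed simp
  qed
  then show "P \<subseteq> monomial_span {w. mpoly_monom w \<in> P}" by (auto simp: monomial_span_def)
qed

text \<open>
  An associated prime of a monomial ideal is generated by variables, and it is the annihilator of
  a monomial. This reduces every statement about associated primes below to a statement about
  exponent vectors: \<open>u\<close> is a witness for \<open>V\<close> if \<open>w + u\<close> lies in \<open>E\<close> exactly when \<open>w\<close> involves a
  variable of \<open>V\<close>.
\<close>

theorem assoc_primes_monomial_span:
  assumes E: "upward_closed E"
  shows "assoc_primes mpoly_ring (monomial_span E :: ('n::finite, 'k::field) mpoly set)
    = {var_prime V |V u. \<forall>w. w + u \<in> E \<longleftrightarrow> w \<in> var_exponents V}"
proof (intro equalityI subsetI)
  fix P :: "('n, 'k) mpoly set"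
  assume "P \<in> {var_prime V |V u. \<forall>w. w + u \<in> E \<longleftrightarrow> w \<in> var_exponents V}"
  then obtain V u where P_def: "P = var_prime V"
    and u: "\<And>w. w + u \<in> E \<longleftrightarrow> w \<in> var_exponents V"
    by blast
  have "r \<in> var_prime V \<longleftrightarrow> r * mpoly_monom u \<in> monomial_span E" for r :: "('n, 'k) mpoly"
    unfolding mult.commute[of r]
    by (auto simp: var_prime_def monomial_span_def keys_mpoly_monom_times add.commute[of u] u)
  then have "var_prime V = {r. r * (mpoly_monom u :: ('n, 'k) mpoly) \<in> monomial_span E}" by blast
  then show "P \<in> assoc_primes mpoly_ring (monomial_span E)"
    unfolding assoc_primes_def P_def mem_Collect_eq
    by (intro conjI primeideal_var_prime bexI[of _ "mpoly_monom u"]) simp_all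
next
  fix P :: "('n, 'k) mpoly set"
  assume "P \<in> assoc_primes mpoly_ring (monomial_span E)"
  then obtain f where P: "primeideal P mpoly_ring" and colon: "P = {r. r * f \<in> monomial_span E}"
    by (auto simp: assoc_primes_def)
  have prime: "\<And>a b. a * b \<in> P \<Longrightarrow> a \<in> P \<or> b \<in> P" and ideal: "ideal P mpoly_ring"
    using P by (auto simp: primeideal_type_algebra_iff)
  define W where "W = {w. (mpoly_monom w :: ('n, 'k) mpoly) \<in> P}"
  have W: "w \<in> W \<longleftrightarrow> (\<forall>v\<in>keys f. w + v \<in> E)" for w
  proof -
    have "w \<in> W \<longleftrightarrow> mpoly_monom w * f \<in> monomial_span E" unfolding W_def using colon by blast
    then show ?thesis by (auto simp: monomial_span_def keys_mpoly_monom_times)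
  qed
  (* If every term of f were multiplied into E by a monomial outside P, the product of these
     monomials would be outside P and would multiply f into the ideal. *)
  have "\<exists>u\<in>keys f. \<forall>w. w + u \<in> E \<longrightarrow> w \<in> W"
  proof (rule ccontr)
    assume "\<not> ?thesis"
    then obtain c where c: "\<And>u. u \<in> keys f \<Longrightarrow> c u + u \<in> E \<and> c u \<notin> W" by metis
    have sum: "(\<Sum>u\<in>S. c u) \<notin> W \<and> (\<forall>u\<in>S. (\<Sum>u\<in>S. c u) + u \<in> E)"
      if "finite S" "S \<subseteq> keys f" for S
      using that
    proof (induction S rule: finite_induct)
      case empty
      have "(0 :: 'n \<Rightarrow>\<^sub>0 nat) \<notin> W"
        using primeideal_mpoly_monom[OF P, of 0] by (auto simp: W_def)
      then show ?case by simp
    next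
      case (insert s S)
      have "c s + (\<Sum>u\<in>S. c u) \<notin> W"
        using prime insert c[of s] by (auto simp: W_def simp flip: mpoly_monom_mult)
      moreover have "c s + (\<Sum>u\<in>S. c u) + s \<in> E"
        using E c[of s] insert.prems
        by (metis add.assoc add.commute insert_subset upward_closed_def)
      moreover have "c s + (\<Sum>u\<in>S. c u) + u \<in> E" if "u \<in> S" for u
        using E insert that by (simp add: upward_closed_def add.assoc)
      ultimately show ?case using insert.hyps by auto
    qed
    from sum[of "keys f"] W show False by auto
  qed
  then obtain u where u: "\<And>w. w + u \<in> E \<longleftrightarrow> w \<in> W" using W by blast
  define V where "V = {i. (mpoly_var i :: ('n, 'k) mpoly) \<in> P}"
  have WV: "W = var_exponents V"
  proof (intro equalityI subsetI)
    fix w assume "w \<in> W"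
    then show "w \<in> var_exponents V"
      using primeideal_mpoly_monom[OF P, of w] by (auto simp: W_def V_def var_exponents_def)
  next
    fix w assume "w \<in> var_exponents V"
    then show "w \<in> W"
      using mpoly_monom_in_ideal[OF ideal] by (auto simp: W_def V_def var_exponents_def)
  qed
  have "P = var_prime V"
    using colon_prime_eq_monomial_span[OF E P colon] by (simp add: var_prime_def W_def flip: WV)
  with u WV show "P \<in> {var_prime V |V u. \<forall>w. w + u \<in> E \<longleftrightarrow> w \<in> var_exponents V}" by blast
qed


section \<open>Ideals in three of the variables\<close>

text \<open>
  All ideals below are extended from the polynomial ring in three of the variables: membership of
  an exponent vector depends on three of its coordinates only.
\<close>

definition cylinder :: "'n \<Rightarrow> 'n \<Rightarrow> 'n \<Rightarrow> (nat \<Rightarrow> nat \<Rightarrow> nat \<Rightarrow> bool) \<Rightarrow> ('n \<Rightarrow>\<^sub>0 nat) set"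
  where "cylinder x y z p = {w. p (lookup w x) (lookup w y) (lookup w z)}"

text \<open>
  The truncated differences are the coordinates of the second summand, so this is the sum of the
  two sets of triples.
\<close>

definition conv :: "(nat \<Rightarrow> nat \<Rightarrow> nat \<Rightarrow> bool) \<Rightarrow> (nat \<Rightarrow> nat \<Rightarrow> nat \<Rightarrow> bool) \<Rightarrow> nat \<Rightarrow> nat \<Rightarrow> nat \<Rightarrow> bool"
  where "conv p q a b c \<longleftrightarrow>
    (\<exists>i\<le>a. \<exists>j\<le>b. \<exists>l\<le>c. p i j l \<and> q (a - i) (b - j) (c - l))"

primrec conv_power :: "(nat \<Rightarrow> nat \<Rightarrow> nat \<Rightarrow> bool) \<Rightarrow> nat \<Rightarrow> nat \<Rightarrow> nat \<Rightarrow> nat \<Rightarrow> bool"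
  where
    "conv_power p 0 = (\<lambda>_ _ _. True)"
  | "conv_power p (Suc t) = conv (conv_power p t) p"

lemma convI:
  assumes "p i j l" and "q i' j' l'"
  shows "conv p q (i + i') (j + j') (l + l')"
  unfolding conv_def
  by (rule exI[of _ i], rule conjI, simp, rule exI[of _ j], rule conjI, simp,
      rule exI[of _ l]) (use assms in simp)

definition triple :: "'n \<Rightarrow> 'n \<Rightarrow> 'n \<Rightarrow> nat \<Rightarrow> nat \<Rightarrow> nat \<Rightarrow> ('n \<Rightarrow>\<^sub>0 nat)"
  where "triple x y z a b c =
    Poly_Mapping.single x a + Poly_Mapping.single y b + Poly_Mapping.single z c"

lemma lookup_triple:
  assumes "distinct [x, y, z]"
  shows "lookup (triple x y z a b c) x = a" "lookup (triple x y z a b c) y = b"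
    "lookup (triple x y z a b c) z = c"
    "i \<notin> {x, y, z} \<Longrightarrow> lookup (triple x y z a b c) i = 0"
  using assms by (auto simp: triple_def lookup_add lookup_single when_def)

text \<open>
  A decomposition of the three coordinates of \<open>w\<close> extends to one of \<open>w\<close> by leaving all the other
  coordinates to the second summand.
\<close>

lemma sumset_cylinder:
  assumes xyz: "distinct [x, y, z]"
  shows "{u + v |u v. u \<in> cylinder x y z p \<and> v \<in> cylinder x y z q} = cylinder x y z (conv p q)"
proof (intro equalityI subsetI)
  fix w assume "w \<in> {u + v |u v. u \<in> cylinder x y z p \<and> v \<in> cylinder x y z q}"
  then obtain u v where w: "w = u + v" and "u \<in> cylinder x y z p" "v \<in> cylinder x y z q" by blast
  then show "w \<in> cylinder x y z (conv p q)"
    unfolding cylinder_def mem_Collect_eq w lookup_add by (intro convI) auto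
next
  fix w assume "w \<in> cylinder x y z (conv p q)"
  then obtain i j l where le: "i \<le> lookup w x" "j \<le> lookup w y" "l \<le> lookup w z"
    and pq: "p i j l" "q (lookup w x - i) (lookup w y - j) (lookup w z - l)"
    by (auto simp: cylinder_def conv_def)
  define u where "u = triple x y z i j l"
  have "lookup u n \<le> lookup w n" for n
    using lookup_triple[OF xyz] le unfolding u_def by (cases "n \<in> {x, y, z}") auto
  then have "w = u + (w - u)"
    by (intro poly_mapping_eqI) (simp add: lookup_add lookup_minus)
  moreover have "u \<in> cylinder x y z p" "w - u \<in> cylinder x y z q"
    using pq by (simp_all add: cylinder_def u_def lookup_triple[OF xyz] lookup_minus)
  ultimately show "w \<in> {u + v |u v. u \<in> cylinder x y z p \<and> v \<in> cylinder x y z q}" by blast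
qed

lemma sumset_power_cylinder:
  assumes "distinct [x, y, z]"
  shows "sumset_power (cylinder x y z p) t = cylinder x y z (conv_power p t)"
proof (induction t)
  case 0
  show ?case by (simp add: cylinder_def)
next
  case (Suc t)
  then show ?case by (simp add: sumset_cylinder[OF assms])
qed

lemma var_prime_in_assoc_primes_cylinder:
  fixes x y z :: "'n::finite"
  assumes "distinct [x, y, z]" and "upward_closed (cylinder x y z p)"
    and "\<And>w. p (lookup w x + a) (lookup w y + b) (lookup w z + c) \<longleftrightarrow> w \<in> var_exponents V"
  shows "var_prime V
    \<in> assoc_primes mpoly_ring (monomial_span (cylinder x y z p) :: ('n, 'k::field) mpoly set)"
proof -
  have "\<forall>w. w + triple x y z a b c \<in> cylinder x y z p \<longleftrightarrow> w \<in> var_exponents V"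
    by (simp add: cylinder_def lookup_add lookup_triple[OF assms(1)] assms(3))
  then show ?thesis unfolding assoc_primes_monomial_span[OF assms(2)] by blast
qed


section \<open>The family of ideals\<close>

text \<open>
  Up to the names of the variables, this is the ideal generated by \<open>x^4\<close>, \<open>x^3 y^2\<close>,
  \<open>x^2 y^4 z^k\<close>, \<open>x y^5 z\<close> and \<open>y^6 z\<close>.
\<close>

definition family_exponent :: "nat \<Rightarrow> nat \<Rightarrow> nat \<Rightarrow> nat \<Rightarrow> bool"
  where "family_exponent k a b c \<longleftrightarrow>
    a \<ge> 4 \<or> a \<ge> 3 \<and> b \<ge> 2 \<or> a \<ge> 2 \<and> b \<ge> 4 \<and> c \<ge> k \<or> a \<ge> 1 \<and> b \<ge> 5 \<and> c \<ge> 1 \<or> b \<ge> 6 \<and> c \<ge> 1"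

definition family :: "'n \<Rightarrow> 'n \<Rightarrow> 'n \<Rightarrow> nat \<Rightarrow> ('n, 'k::field) mpoly set"
  where "family x y z k = monomial_span (cylinder x y z (family_exponent k))"

lemma upward_closed_family: "upward_closed (cylinder x y z (family_exponent k))"
  by (auto simp: upward_closed_def cylinder_def family_exponent_def lookup_add)

lemma monomial_ideal_family: "monomial_ideal (family x y z k :: ('n, 'k::field) mpoly set)"
  unfolding family_def by (rule monomial_ideal_span[OF upward_closed_family])

lemma ideal_power_family:
  assumes "distinct [x, y, z]"
  shows "ideal_power mpoly_ring (family x y z k) t
    = (monomial_span (cylinder x y z (conv_power (family_exponent k) t)) :: ('n, 'k::field) mpoly set)"
  by (simp add: family_def ideal_power_monomial_span upward_closed_family
      sumset_power_cylinder[OF assms])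

lemma upward_closed_family_power:
  assumes "distinct [x, y, z]"
  shows "upward_closed (cylinder x y z (conv_power (family_exponent k) t))"
  using upward_closed_sumset_power[of "cylinder x y z (family_exponent k)" t]
  by (simp add: sumset_power_cylinder[OF assms])

lemma conv_power_one: "conv_power (family_exponent k) 1 = family_exponent k"
proof (intro ext iffI)
  fix a b c assume "conv_power (family_exponent k) 1 a b c"
  then show "family_exponent k a b c" by (auto simp: conv_def family_exponent_def)
next
  fix a b c assume "family_exponent k a b c"
  then show "conv_power (family_exponent k) 1 a b c"
    using convI[of "\<lambda>_ _ _. True" 0 0 0 "family_exponent k" a b c] by simp
qed

text \<open>
  The exponents of the square, by its irreducible decomposition: each clause is one irreducible
  component. For instance the first one is the ideal generated by \<open>x^8\<close> and \<open>y^2\<close>.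
\<close>

definition square_exponent :: "nat \<Rightarrow> nat \<Rightarrow> nat \<Rightarrow> bool"
  where "square_exponent a b c \<longleftrightarrow>
    (a \<ge> 8 \<or> b \<ge> 2) \<and> (a \<ge> 7 \<or> b \<ge> 4) \<and> (a \<ge> 6 \<or> b \<ge> 5) \<and> (a \<ge> 5 \<or> b \<ge> 6) \<and>
    (a \<ge> 4 \<or> b \<ge> 8) \<and> (a \<ge> 3 \<or> b \<ge> 10) \<and> (a \<ge> 2 \<or> b \<ge> 11) \<and> (a \<ge> 1 \<or> b \<ge> 12) \<and>
    (a \<ge> 6 \<or> c \<ge> 1) \<and> (a \<ge> 3 \<or> c \<ge> 2)"

text \<open>
  The generator with \<open>z^k\<close> is superfluous in the square, because its products with the five
  generators are multiples of the products
  \<open>x^3 y^2 * x^3 y^2\<close>, \<open>x^4 * x y^5 z\<close>, \<open>x^4 * y^6 z\<close>, \<open>x^3 y^2 * y^6 z\<close> and \<open>x y^5 z * x y^5 z\<close>,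
  provided that \<open>k \<ge> 1\<close>.
  This is why the square is independent of \<open>k\<close>.
\<close>

lemma conv_power_two:
  assumes k: "k \<ge> 1"
  shows "conv_power (family_exponent k) 2 = square_exponent"
proof -
  have "conv (family_exponent k) (family_exponent k) a b c \<longleftrightarrow> square_exponent a b c" for a b c
  proof
    have *: "square_exponent (i + i') (j + j') (l + l')"
      if "family_exponent k i j l" "family_exponent k i' j' l'" for i i' j j' l l'
      using that k unfolding family_exponent_def by (elim disjE conjE) (simp_all add: square_exponent_def)
    assume "conv (family_exponent k) (family_exponent k) a b c"
    then show "square_exponent a b c" unfolding conv_def using * by fastforce
  next
    have split: "conv (family_exponent k) (family_exponent k) a b c"
      if "i \<le> a" "j \<le> b" "l \<le> c" "family_exponent k i j l"
        "family_exponent k (a - i) (b - j) (c - l)" for i j l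
      using that unfolding conv_def by blast
    assume "square_exponent a b c"
    then consider "a \<ge> 8" | "a \<ge> 7" "b \<ge> 2" | "a \<ge> 6" "b \<ge> 4"
      | "a \<ge> 5" "b \<ge> 5" "c \<ge> 1" | "a \<ge> 4" "b \<ge> 6" "c \<ge> 1" | "a \<ge> 3" "b \<ge> 8" "c \<ge> 1"
      | "a \<ge> 2" "b \<ge> 10" "c \<ge> 2" | "a \<ge> 1" "b \<ge> 11" "c \<ge> 2" | "b \<ge> 12" "c \<ge> 2"
      unfolding square_exponent_def by atomize_elim auto
    then show "conv (family_exponent k) (family_exponent k) a b c"
    proof cases
      case 1 then show ?thesis by (intro split[of 4 0 0]) (auto simp: family_exponent_def)
    next
      case 2 then show ?thesis by (intro split[of 4 0 0]) (auto simp: family_exponent_def)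
    next
      case 3 then show ?thesis by (intro split[of 3 2 0]) (auto simp: family_exponent_def)
    next
      case 4 then show ?thesis by (intro split[of 4 0 0]) (auto simp: family_exponent_def)
    next
      case 5 then show ?thesis by (intro split[of 4 0 0]) (auto simp: family_exponent_def)
    next
      case 6 then show ?thesis by (intro split[of 3 2 0]) (auto simp: family_exponent_def)
    next
      case 7 then show ?thesis by (intro split[of 1 5 1]) (auto simp: family_exponent_def)
    next
      case 8 then show ?thesis by (intro split[of 1 5 1]) (auto simp: family_exponent_def)
    next
      case 9 then show ?thesis by (intro split[of 0 6 1]) (auto simp: family_exponent_def)
    qed
  qed
  then have "conv (family_exponent k) (family_exponent k) = square_exponent" by (intro ext)
  moreover have "conv_power (family_exponent k) 2
      = conv (conv_power (family_exponent k) 1) (family_exponent k)"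
    by (simp add: numeral_2_eq_2)
  ultimately show ?thesis by (simp only: conv_power_one)
qed

text \<open>
  No irreducible component of the square involves both \<open>y\<close> and \<open>z\<close>, so none of them is primary to
  the ideal of all three variables.
\<close>

lemma square_exponent_saturated:
  assumes "square_exponent a (b + 1) c" and "square_exponent a b (c + 1)"
  shows "square_exponent a b c"
  using assms by (simp add: square_exponent_def)

text \<open>
  The monomial \<open>x^9 y^5\<close> is not in the cube: among the products of three generators that are
  free of \<open>z\<close>, all of whose factors are \<open>x^4\<close> or \<open>x^3 y^2\<close>, the only one of \<open>x\<close>-degree at most 9
  is \<open>x^9 y^6\<close>. The multiples of \<open>x^9 y^5\<close> by \<open>x\<close>, \<open>y\<close> and \<open>z\<close> are multiples of \<open>x^4 * x^3 y^2 * x^3 y^2\<close>, \<open>(x^3 y^2)^3\<close> and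
  \<open>x^4 * x^4 * x y^5 z\<close>.
\<close>

lemma cube_exponent_socle:
  assumes k: "k \<ge> 1"
  shows "conv_power (family_exponent k) 3 (i + 9) (j + 5) l \<longleftrightarrow> i \<noteq> 0 \<or> j \<noteq> 0 \<or> l \<noteq> 0"
proof -
  have "conv_power (family_exponent k) 3
      = conv (conv_power (family_exponent k) 2) (family_exponent k)"
    by (simp add: numeral_3_eq_3 numeral_2_eq_2)
  then have three: "conv_power (family_exponent k) 3 = conv square_exponent (family_exponent k)"
    by (simp only: conv_power_two[OF k])
  have split: "conv square_exponent (family_exponent k) a b c"
    if "i \<le> a" "j \<le> b" "l \<le> c" "square_exponent i j l"
      "family_exponent k (a - i) (b - j) (c - l)" for a b c i j l
    using that unfolding conv_def by blast
  show ?thesis unfolding three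
  proof
    assume *: "conv square_exponent (family_exponent k) (i + 9) (j + 5) l"
    have "\<not> conv square_exponent (family_exponent k) 9 5 0"
      using k by (auto simp: conv_def square_exponent_def family_exponent_def)
    with * show "i \<noteq> 0 \<or> j \<noteq> 0 \<or> l \<noteq> 0" by (cases "i = 0"; cases "j = 0"; cases "l = 0") simp_all
  next
    assume *: "i \<noteq> 0 \<or> j \<noteq> 0 \<or> l \<noteq> 0"
    show "conv square_exponent (family_exponent k) (i + 9) (j + 5) l"
    proof (cases "l = 0")
      case True
      with * show ?thesis
        by (intro split[of "i + 6" _ "j + 3" _ 0])
          (auto simp: square_exponent_def family_exponent_def)
    next
      case False
      then show ?thesis
        by (intro split[of "i + 8" _ j _ "l - 1"])
          (auto simp: square_exponent_def family_exponent_def)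
    qed
  qed
qed

text \<open>
  Every power of the ideal contains a power of \<open>x\<close> and a monomial in \<open>y\<close> and \<open>z\<close>. Hence each of its
  associated primes contains \<open>x\<close>, and \<open>y\<close> or \<open>z\<close>.
\<close>

lemma conv_power_family_vertices:
  "conv_power (family_exponent k) t (4 * t + a) b c"
  "conv_power (family_exponent k) t a (6 * t + b) (t + c)"
proof (induction t)
  case (Suc t)
  {
    case 1
    have "family_exponent k 4 0 0" by (simp add: family_exponent_def)
    from convI[of "conv_power (family_exponent k) t" "4 * t + a" b c "family_exponent k" 4 0 0, OF Suc(1) this] show ?case
      by (simp add: algebra_simps)
  next
    case 2
    have "family_exponent k 0 6 1" by (simp add: family_exponent_def)
    from convI[of "conv_power (family_exponent k) t" a "6 * t + b" "t + c" "family_exponent k" 0 6 1, OF Suc(2) this] show ?case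
      by (simp add: algebra_simps)
  }
qed simp_all

text \<open>
  A variable other than \<open>x\<close>, \<open>y\<close> and \<open>z\<close> cannot be in an associated prime, since multiplying by
  it does not change membership in the ideal.
\<close>

lemma assoc_primes_family_power_subset:
  fixes x y z :: "'n::finite"
  assumes xyz: "distinct [x, y, z]"
  shows "assoc_primes mpoly_ring (ideal_power mpoly_ring (family x y z k :: ('n, 'k::field) mpoly set) t)
    \<subseteq> {var_prime {x, y}, var_prime {x, z}, var_prime {x, y, z}}"
proof
  define E where "E = cylinder x y z (conv_power (family_exponent k) t)"
  fix P :: "('n, 'k) mpoly set"
  assume "P \<in> assoc_primes mpoly_ring (ideal_power mpoly_ring (family x y z k) t)"
  then obtain V u where P: "P = var_prime V"
    and u: "\<And>w. w + u \<in> E \<longleftrightarrow> w \<in> var_exponents V"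
    unfolding ideal_power_family[OF xyz]
      assoc_primes_monomial_span[OF upward_closed_family_power[OF xyz]] E_def by blast
  have "V \<subseteq> {x, y, z}"
  proof
    fix i assume "i \<in> V"
    then have "Poly_Mapping.single i (Suc 0) + u \<in> E" unfolding u by simp
    moreover have "0 + u \<notin> E" unfolding u by (simp add: var_exponents_def)
    ultimately show "i \<in> {x, y, z}"
      by (auto simp: E_def cylinder_def lookup_add lookup_single when_def split: if_splits)
  qed
  moreover have "x \<in> V"
  proof -
    have "Poly_Mapping.single x (4 * t) + u \<in> E"
      using xyz conv_power_family_vertices(1)[of k t "lookup u x"]
      by (simp add: E_def cylinder_def lookup_add lookup_single)
    then show ?thesis
      unfolding u by (auto simp: var_exponents_def lookup_single when_def split: if_splits)
  qed
  moreover have "y \<in> V \<or> z \<in> V"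
  proof -
    have "Poly_Mapping.single y (6 * t) + Poly_Mapping.single z t + u \<in> E"
      using xyz conv_power_family_vertices(2)[of k t _ "lookup u y" "lookup u z"]
      by (auto simp: E_def cylinder_def lookup_add lookup_single when_def)
    then show ?thesis
      unfolding u
      by (auto simp: var_exponents_def lookup_add lookup_single when_def split: if_splits)
  qed
  ultimately have "V \<in> {{x, y}, {x, z}, {x, y, z}}" by blast
  then show "P \<in> {var_prime {x, y}, var_prime {x, z}, var_prime {x, y, z}}"
    unfolding P by blast
qed

text \<open>
  The three primes are the annihilators of \<open>x^3 y\<close>, \<open>x^2 y^6\<close> and \<open>x^2 y^4 z^(k - 1)\<close>
  modulo the ideal.
\<close>

lemma assoc_primes_family:
  fixes x y z :: "'n::finite"
  assumes xyz: "distinct [x, y, z]" and k: "k \<ge> 2"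
  shows "assoc_primes mpoly_ring (ideal_power mpoly_ring (family x y z k :: ('n, 'k::field) mpoly set) 1)
    = {var_prime {x, y}, var_prime {x, z}, var_prime {x, y, z}}"
proof (rule equalityI[OF assoc_primes_family_power_subset[OF xyz]])
  have pow: "ideal_power mpoly_ring (family x y z k :: ('n, 'k) mpoly set) 1
      = monomial_span (cylinder x y z (family_exponent k))"
    unfolding ideal_power_family[OF xyz] conv_power_one ..
  note witness = var_prime_in_assoc_primes_cylinder[OF xyz upward_closed_family]
  have "var_prime {x, y}
      \<in> assoc_primes mpoly_ring (monomial_span (cylinder x y z (family_exponent k)) :: ('n, 'k) mpoly set)"
    by (rule witness[where a = 3 and b = 1 and c = 0])
      (auto simp: family_exponent_def var_exponents_def)
  moreover have "var_prime {x, z}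
      \<in> assoc_primes mpoly_ring (monomial_span (cylinder x y z (family_exponent k)) :: ('n, 'k) mpoly set)"
    using k by (intro witness[where a = 2 and b = 6 and c = 0])
      (auto simp: family_exponent_def var_exponents_def)
  moreover have "var_prime {x, y, z}
      \<in> assoc_primes mpoly_ring (monomial_span (cylinder x y z (family_exponent k)) :: ('n, 'k) mpoly set)"
    using k by (intro witness[where a = 2 and b = 4 and c = "k - 1"])
      (auto simp: family_exponent_def var_exponents_def)
  ultimately show "{var_prime {x, y}, var_prime {x, z}, var_prime {x, y, z}}
      \<subseteq> assoc_primes mpoly_ring (ideal_power mpoly_ring (family x y z k :: ('n, 'k) mpoly set) 1)"
    unfolding pow by blast
qed

text \<open>
  A prime containing the ideal contains \<open>x\<close> because of \<open>x^4\<close>, and \<open>y\<close> or \<open>z\<close> because of \<open>y^6 z\<close>.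
\<close>

lemma minimal_primes_family:
  fixes x y z :: "'n::finite"
  assumes xyz: "distinct [x, y, z]"
  shows "minimal_primes mpoly_ring (family x y z k :: ('n, 'k::field) mpoly set)
    = {var_prime {x, y}, var_prime {x, z}}"
proof -
  let ?I = "family x y z k :: ('n, 'k) mpoly set"
  have below: "var_prime {x, y} \<subseteq> Q \<or> var_prime {x, z} \<subseteq> Q"
    if Q: "primeideal Q mpoly_ring" and I: "?I \<subseteq> Q" for Q
  proof -
    have "mpoly_monom (triple x y z 4 0 0) \<in> ?I" "mpoly_monom (triple x y z 0 6 1) \<in> ?I"
      by (simp_all add: family_def cylinder_def lookup_triple[OF xyz] family_exponent_def)
    then have *: "mpoly_monom (triple x y z 4 0 0) \<in> Q" "mpoly_monom (triple x y z 0 6 1) \<in> Q"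
      using I by auto
    have x: "mpoly_var x \<in> Q"
      using primeideal_mpoly_monom[OF Q *(1)] lookup_triple[OF xyz]
      by (metis insertE singletonD)
    have yz: "mpoly_var y \<in> Q \<or> mpoly_var z \<in> Q"
      using primeideal_mpoly_monom[OF Q *(2)] lookup_triple[OF xyz]
      by (metis insertE singletonD)
    have ideal: "ideal Q mpoly_ring" using Q by (simp add: primeideal_type_algebra_iff)
    from yz show ?thesis
    proof
      assume "mpoly_var y \<in> Q"
      with x have "var_prime {x, y} \<subseteq> Q" by (intro var_prime_subset_ideal[OF ideal]) auto
      then show ?thesis ..
    next
      assume "mpoly_var z \<in> Q"
      with x have "var_prime {x, z} \<subseteq> Q" by (intro var_prime_subset_ideal[OF ideal]) auto
      then show ?thesis ..
    qed
  qed
  have "cylinder x y z (family_exponent k) \<subseteq> var_exponents {x, y}"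
    "cylinder x y z (family_exponent k) \<subseteq> var_exponents {x, z}"
    by (auto simp: cylinder_def var_exponents_def family_exponent_def)
  then have contains: "?I \<subseteq> var_prime {x, y}" "?I \<subseteq> var_prime {x, z}"
    by (auto simp: family_def var_prime_def monomial_span_def)
  have incomparable: "\<not> (var_prime {x, z} :: ('n, 'k) mpoly set) \<subseteq> var_prime {x, y}"
    "\<not> (var_prime {x, y} :: ('n, 'k) mpoly set) \<subseteq> var_prime {x, z}"
    using xyz by auto
  show ?thesis
  proof (intro equalityI subsetI)
    fix P assume "P \<in> minimal_primes mpoly_ring ?I"
    then have P: "primeideal P mpoly_ring" "?I \<subseteq> P"
      and least: "\<And>Q. primeideal Q mpoly_ring \<Longrightarrow> ?I \<subseteq> Q \<Longrightarrow> Q \<subseteq> P \<Longrightarrow> Q = P"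
      by (auto simp: minimal_primes_def)
    from below[OF P] show "P \<in> {var_prime {x, y}, var_prime {x, z}}"
      using least[OF primeideal_var_prime contains(1)] least[OF primeideal_var_prime contains(2)]
      by auto
  next
    have "Q = var_prime {x, y}"
      if "primeideal Q mpoly_ring" "?I \<subseteq> Q" "Q \<subseteq> var_prime {x, y}" for Q
      using below[OF that(1,2)] that(3) incomparable(1) by (meson subset_antisym subset_trans)
    moreover have "Q = var_prime {x, z}"
      if "primeideal Q mpoly_ring" "?I \<subseteq> Q" "Q \<subseteq> var_prime {x, z}" for Q
      using below[OF that(1,2)] that(3) incomparable(2) by (meson subset_antisym subset_trans)
    moreover fix P :: "('n, 'k) mpoly set"
    assume "P \<in> {var_prime {x, y}, var_prime {x, z}}"
    ultimately show "P \<in> minimal_primes mpoly_ring ?I"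
      using primeideal_var_prime contains unfolding minimal_primes_def by auto
  qed
qed

lemma co_nearly_normally_torsion_free_family:
  fixes x y z :: "'n::finite"
  assumes xyz: "distinct [x, y, z]" and k: "k \<ge> 2"
  shows "co_nearly_normally_torsion_free (family x y z k :: ('n, 'k::field) mpoly set)"
  unfolding co_nearly_normally_torsion_free_def minimal_primes_family[OF xyz]
proof (intro conjI exI[of _ "var_prime {x, y, z}"] exI[of _ 1] allI impI)
  show "monomial_ideal (family x y z k :: ('n, 'k) mpoly set)"
    by (rule monomial_ideal_family)
  show "monomial_prime_ideal (var_prime {x, y, z} :: ('n, 'k) mpoly set)"
    by (rule monomial_prime_ideal_var_prime)
  fix t :: nat
  show "assoc_primes mpoly_ring (ideal_power mpoly_ring (family x y z k :: ('n, 'k) mpoly set) t)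
      = {var_prime {x, y}, var_prime {x, z}} \<union> {var_prime {x, y, z}}" if "1 \<le> t \<and> t \<le> 1"
    using assoc_primes_family[OF xyz k, where 'k = 'k] that by (auto simp: le_antisym)
  show "assoc_primes mpoly_ring (ideal_power mpoly_ring (family x y z k :: ('n, 'k) mpoly set) t)
      \<subseteq> {var_prime {x, y}, var_prime {x, z}} \<union> {var_prime {x, y, z}}"
    using assoc_primes_family_power_subset[OF xyz, where 'k = 'k] by auto
qed simp

lemma not_copersistence_family:
  fixes x y z :: "'n::finite"
  assumes xyz: "distinct [x, y, z]" and k: "k \<ge> 1"
  shows "\<not> copersistence mpoly_ring (family x y z k :: ('n, 'k::field) mpoly set)"
proof
  let ?I = "family x y z k :: ('n, 'k) mpoly set"
  assume "copersistence mpoly_ring ?I"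
  then have le: "assoc_primes mpoly_ring (ideal_power mpoly_ring ?I 3)
      \<subseteq> assoc_primes mpoly_ring (ideal_power mpoly_ring ?I 2)"
    unfolding copersistence_def by (drule_tac spec[of _ 2]) simp
  have "var_prime {x, y, z} \<in> assoc_primes mpoly_ring (ideal_power mpoly_ring ?I 3)"
    unfolding ideal_power_family[OF xyz]
    using cube_exponent_socle[OF k]
    by (intro var_prime_in_assoc_primes_cylinder[OF xyz upward_closed_family_power[OF xyz],
          where a = 9 and b = 5 and c = 0]) (auto simp: var_exponents_def)
  with le have two: "var_prime {x, y, z}
      \<in> assoc_primes mpoly_ring (ideal_power mpoly_ring ?I 2)" by blast
  have "upward_closed (cylinder x y z square_exponent)"
    using upward_closed_family_power[OF xyz, of k 2] by (simp only: conv_power_two[OF k])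
  note assoc = assoc_primes_monomial_span[OF this, where 'k = 'k]
  from two obtain u where u: "\<And>w. w + u \<in> cylinder x y z square_exponent
      \<longleftrightarrow> w \<in> var_exponents {x, y, z}"
    unfolding ideal_power_family[OF xyz] conv_power_two[OF k] assoc by auto
  have "Poly_Mapping.single y (Suc 0) + u \<in> cylinder x y z square_exponent"
    "Poly_Mapping.single z (Suc 0) + u \<in> cylinder x y z square_exponent"
    unfolding u by simp_all
  moreover have "0 + u \<notin> cylinder x y z square_exponent"
    unfolding u by (simp add: var_exponents_def)
  ultimately show False
    using xyz square_exponent_saturated[of "lookup u x" "lookup u y" "lookup u z"]
    by (auto simp: cylinder_def lookup_add lookup_single when_def)
qed

lemma family_inject:
  assumes xyz: "distinct [x, y, z]"
    and eq: "(family x y z k :: ('n, 'k::field) mpoly set) = family x y z k'"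
  shows "k = k'"
proof -
  have "triple x y z 2 4 n \<in> cylinder x y z (family_exponent k) \<longleftrightarrow> k \<le> n" for n k
    by (auto simp: cylinder_def lookup_triple[OF xyz] family_exponent_def)
  moreover have "cylinder x y z (family_exponent k) = cylinder x y z (family_exponent k')"
    using eq unfolding family_def by (rule monomial_span_inject)
  ultimately show ?thesis by (metis le_antisym order_refl)
qed

theorem proposition5p20:
  assumes "CARD('n::finite) \<ge> 3"
  shows "infinite {I :: ('n, 'k::field) mpoly set.
    monomial_ideal I \<and> co_nearly_normally_torsion_free I \<and> \<not> copersistence mpoly_ring I}"
proof -
  obtain S :: "'n set" where "card S = 3"
    using obtain_subset_with_card_n[OF assms] by blast
  then obtain x y z :: 'n where xyz: "distinct [x, y, z]" by (auto simp: card_3_iff)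
  have "inj_on (family x y z :: nat \<Rightarrow> ('n, 'k) mpoly set) {2..}"
    using family_inject[OF xyz] by (auto intro!: inj_onI)
  then have "infinite ((family x y z :: nat \<Rightarrow> ('n, 'k) mpoly set) ` {2..})"
    using finite_imageD infinite_Ici by blast
  moreover have "(family x y z :: nat \<Rightarrow> ('n, 'k) mpoly set) ` {2..} \<subseteq>
      {I. monomial_ideal I \<and> co_nearly_normally_torsion_free I \<and> \<not> copersistence mpoly_ring I}"
    using monomial_ideal_family co_nearly_normally_torsion_free_family[OF xyz, where 'k = 'k]
      not_copersistence_family[OF xyz, where 'k = 'k] by auto
  ultimately show ?thesis using finite_subset by blast
qed

end
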